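(* Let $q\ge 2$ and $d=2q-3$, let $I$ be a parity class of $Q_d$ with complementary parity class $D$, and let $c$ be an extremal pair-defensive $q$-colouring of $Q_d$ with attacked parity $I$ and colour classes $C_i=c^{-1}(i)$. Then for every $x\in I$ the closed profile $$\bigl(|N[x]\cap C_i|\bigr)_{i=1}^q$$ is a permutation of $(1,1,2,\dots,2)$ (a vector of length $q$). One of the two entries equal to $1$ corresponds to the colour $c(x)$ and is realized by $x$ itself. The other corresponds to a unique defender in $D$ (the unique vertex of that colour in $N[x]$, which lies in $D$). These latter defenders define a perfect matching between $I$ and $D$ (i.e. sending $x\in I$ to this defender is a bijection $I\to D$).
   Context: The hypercube $Q_d$ is the graph on $\mathbb F_2^d$ in which two vertices are adjacent when they differ in exactly one coordinate; $[q]=\{1,\dots,q\}$. Its two parity classes are the vectors of even Hamming weight and those of odd Hamming weight; $I$ is one of them (the attacked parity) and $D$ the other (the defender parity). $N(x)$ is the open neighbourhood in $Q_d$ and $N[x]=N(x)\cup\{x\}$. A pair-defensive $q$-colouring with attacked parity $I$ (an $(I,2,q)$-defensive silver colouring) is a surjective proper colouring $c:V(Q_d)\to[q]$, with colour classes $C_i=c^{-1}(i)$, such that for every colour $i\in[q]$ and every $S\subseteq I$ with $|S|\le 2$ there is an injective map $f:S\to C_i$ with $f(x)\in N[x]$ for all $x\in S$. Such a colouring is called extremal if it attains the bound $q=\lfloor (d+3)/2\rfloor$ on the number of colours; for $d=2q-3$ this means simply that it uses $q$ colours. *)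

theory Defs
  imports
    "HOL-Analysis.Finite_Cartesian_Product"
    "HOL-Library.Z2"
    "HOL-Combinatorics.List_Permutation"
begin

text \<open>
  The hypercube \<open>Q\<^sub>d\<close> is the graph on the whole type \<^typ>\<open>bit ^ 'n\<close>, where \<^typ>\<open>bit\<close> is the
  two-element field and the dimension is \<open>d = CARD('n)\<close>.
\<close>

(* Makes the vertex type finite: in particular, bounds on card S below are never met by an
   infinite set S. *)
instance bit :: finite
proof
  have "x \<in> {0, 1}" for x :: bit
    by (cases x) auto
  then show "finite (UNIV :: bit set)"
    by (metis finite.simps finite_subset subsetI)
qed

definition hypercube_adj :: "bit ^ 'n \<Rightarrow> bit ^ 'n \<Rightarrow> bool" where
  "hypercube_adj x y \<longleftrightarrow> card {i. x $ i \<noteq> y $ i} = 1"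

definition open_nbhd :: "bit ^ 'n \<Rightarrow> (bit ^ 'n) set" where
  "open_nbhd x = {y. hypercube_adj x y}"

definition closed_nbhd :: "bit ^ 'n \<Rightarrow> (bit ^ 'n) set" where
  "closed_nbhd x = open_nbhd x \<union> {x}"

definition hamming_weight :: "bit ^ 'n \<Rightarrow> nat" where
  "hamming_weight x = card {i. x $ i \<noteq> 0}"

definition even_class :: "(bit ^ 'n) set" where
  "even_class = {x. even (hamming_weight x)}"

definition odd_class :: "(bit ^ 'n) set" where
  "odd_class = {x. odd (hamming_weight x)}"

definition colour_class :: "(bit ^ 'n \<Rightarrow> nat) \<Rightarrow> nat \<Rightarrow> (bit ^ 'n) set" where
  "colour_class c i = {x. c x = i}"

definition proper_colouring :: "(bit ^ 'n \<Rightarrow> nat) \<Rightarrow> bool" where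
  "proper_colouring c \<longleftrightarrow> (\<forall>x y. hypercube_adj x y \<longrightarrow> c x \<noteq> c y)"

definition defensive_silver_colouring ::
    "(bit ^ 'n) set \<Rightarrow> nat \<Rightarrow> nat \<Rightarrow> (bit ^ 'n \<Rightarrow> nat) \<Rightarrow> bool" where
  "defensive_silver_colouring I k q c \<longleftrightarrow>
     range c = {1..q} \<and> proper_colouring c \<and>
     (\<forall>i\<in>{1..q}. \<forall>S. S \<subseteq> I \<and> card S \<le> k \<longrightarrow>
        (\<exists>f. inj_on f S \<and> (\<forall>x\<in>S. f x \<in> colour_class c i \<and> f x \<in> closed_nbhd x)))"

definition pair_defensive_colouring ::
    "(bit ^ 'n) set \<Rightarrow> nat \<Rightarrow> (bit ^ 'n \<Rightarrow> nat) \<Rightarrow> bool" where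
  "pair_defensive_colouring I q c \<longleftrightarrow> defensive_silver_colouring I 2 q c"

definition extremal_pair_defensive_colouring ::
    "(bit ^ 'n) set \<Rightarrow> nat \<Rightarrow> (bit ^ 'n \<Rightarrow> nat) \<Rightarrow> bool" where
  "extremal_pair_defensive_colouring I q c \<longleftrightarrow>
     pair_defensive_colouring I q c \<and> q = (CARD('n) + 3) div 2"

definition closed_profile :: "(bit ^ 'n \<Rightarrow> nat) \<Rightarrow> nat \<Rightarrow> bit ^ 'n \<Rightarrow> nat list" where
  "closed_profile c q x = map (\<lambda>i. card (closed_nbhd x \<inter> colour_class c i)) [1..<q + 1]"

end

theory Submission
  imports Defs
begin

text \<open>
  Fix \<open>x \<in> I\<close>. Its closed neighbourhood has \<open>d + 1 = 2q - 2\<close> vertices, every colour occurs there,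
  and the colour of \<open>x\<close> occurs only at \<open>x\<close> because the colouring is proper. The remaining \<open>q - 1\<close>
  colours share \<open>2q - 3\<close> neighbours, so they cannot all occur twice: some neighbour \<open>v\<close> is the only
  vertex of its colour in \<open>N[x]\<close>. Such a \<open>v\<close> is called a sole defender of \<open>x\<close> below
  (lemma \<open>sole_defender_exists\<close>).

  The pair condition enters through the observation that a vertex cannot be the sole defender of two
  attacked vertices, since these two would both have to be matched to it (lemma
  \<open>sole_defender_of_unique\<close>). Choosing a sole defender for each \<open>x \<in> I\<close> therefore gives an injection
  \<open>I \<rightarrow> D\<close>. The parity classes have the same size, so it is a bijection. If \<open>x\<close> had a second sole
  defender \<open>w\<close>, then \<open>w\<close> would also be the chosen defender of some vertex, which has to be \<open>x\<close> itself;
  hence sole defenders are unique. So exactly two colours occur once in \<open>N[x]\<close>, the other \<open>q - 2\<close>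
  colours occur at least twice, and as they share \<open>2q - 4\<close> vertices they occur exactly twice.
\<close>

section \<open>Neighbourhoods and parity in the hypercube\<close>

definition flip :: "'n \<Rightarrow> bit ^ 'n \<Rightarrow> bit ^ 'n" where
  "flip i x = (\<chi> j. if j = i then x $ j + 1 else x $ j)"

lemma bit_add_one_neq: "(b :: bit) + 1 \<noteq> b"
  by (cases b) auto

lemma differing_coordinates_flip: "{j. x $ j \<noteq> flip i x $ j} = {i}"
  by (auto simp: flip_def bit_add_one_neq bit_add_one_neq[symmetric] split: if_splits)

lemma flip_flip [simp]: "flip i (flip i x) = x"
proof -
  have "(b :: bit) + 1 + 1 = b" for b
    by (cases b) auto
  then show ?thesis
    by (simp add: flip_def vec_eq_iff)
qed

lemma hypercube_adj_iff_flip: "hypercube_adj x y \<longleftrightarrow> (\<exists>i. y = flip i x)"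
proof
  assume "hypercube_adj x y"
  then obtain i where i: "{j. x $ j \<noteq> y $ j} = {i}"
    unfolding hypercube_adj_def by (auto simp: card_1_singleton_iff)
  have "y $ j = flip i x $ j" for j
  proof (cases "j = i")
    case True
    with i have "x $ j \<noteq> y $ j" by blast
    with True show ?thesis by (cases "x $ i"; cases "y $ i") (simp_all add: flip_def)
  next
    case False
    with i have "x $ j = y $ j" by blast
    with False show ?thesis by (simp add: flip_def)
  qed
  then show "\<exists>i. y = flip i x"
    by (auto simp: vec_eq_iff)
next
  assume "\<exists>i. y = flip i x"
  then show "hypercube_adj x y"
    by (auto simp: hypercube_adj_def differing_coordinates_flip)
qed

lemma not_hypercube_adj_refl: "\<not> hypercube_adj x x"
  by (simp add: hypercube_adj_def)

lemma in_closed_nbhd_iff: "y \<in> closed_nbhd x \<longleftrightarrow> y = x \<or> hypercube_adj x y"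
  by (auto simp: closed_nbhd_def open_nbhd_def)

lemma inj_flip: "inj (\<lambda>i. flip i x)"
proof (rule injI)
  fix i j
  assume eq: "flip i x = flip j x"
  have "{i} = {k. x $ k \<noteq> flip i x $ k}"
    by (rule differing_coordinates_flip[symmetric])
  also have "\<dots> = {j}"
    unfolding eq by (rule differing_coordinates_flip)
  finally show "i = j"
    by simp
qed

lemma card_closed_nbhd: "card (closed_nbhd (x :: bit ^ 'n)) = CARD('n) + 1"
proof -
  have "open_nbhd x = range (\<lambda>i. flip i x)"
    unfolding open_nbhd_def hypercube_adj_iff_flip full_SetCompr_eq ..
  then have card: "card (open_nbhd x) = CARD('n)"
    using card_image[OF inj_flip[of x]] by argo
  have notin: "x \<notin> open_nbhd x"
    by (simp add: open_nbhd_def not_hypercube_adj_refl)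
  show ?thesis
    unfolding closed_nbhd_def using card card_insert_disjoint[OF finite notin] by simp
qed

lemma even_hamming_weight_flip: "even (hamming_weight (flip i x)) \<longleftrightarrow> odd (hamming_weight x)"
proof -
  let ?A = "{j. x $ j \<noteq> 0}"
  have flipped: "{j. flip i x $ j \<noteq> 0} = (if i \<in> ?A then ?A - {i} else insert i ?A)"
    by (cases "x $ i") (auto simp: flip_def)
  show ?thesis
  proof (cases "i \<in> ?A")
    case True
    then have "card ?A = Suc (card (?A - {i}))"
      by (metis card_Suc_Diff1 finite)
    with True flipped have "hamming_weight x = Suc (hamming_weight (flip i x))"
      unfolding hamming_weight_def by argo
    then show ?thesis
      by simp
  next
    case False
    with flipped show ?thesis
      by (simp add: hamming_weight_def)
  qed
qed

text \<open>Flipping one fixed coordinate exchanges the two parity classes.\<close>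

lemma card_even_class: "card (even_class :: (bit ^ 'n) set) = card (odd_class :: (bit ^ 'n) set)"
proof (rule bij_betw_same_card)
  show "bij_betw (flip (undefined :: 'n)) even_class odd_class"
    by (rule bij_betw_byWitness[where f' = "flip undefined"])
      (auto simp: even_class_def odd_class_def even_hamming_weight_flip)
qed

section \<open>Sole defenders\<close>

definition sole_defender :: "(bit ^ 'n \<Rightarrow> nat) \<Rightarrow> bit ^ 'n \<Rightarrow> bit ^ 'n \<Rightarrow> bool" where
  "sole_defender c x v \<longleftrightarrow> hypercube_adj x v \<and> closed_nbhd x \<inter> colour_class c (c v) = {v}"

lemma proper_colouring_adj_neq:
  assumes "proper_colouring c" and "hypercube_adj x y"
  shows "c y \<noteq> c x"
  using assms unfolding proper_colouring_def by metis

lemma closed_nbhd_own_colour: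
  assumes "proper_colouring c"
  shows "closed_nbhd x \<inter> colour_class c (c x) = {x}"
  using proper_colouring_adj_neq[OF assms] by (auto simp: in_closed_nbhd_iff colour_class_def)

text \<open>
  The counting arguments concern colours, the matching argument concerns vertices; this equivalence
  translates between them.
\<close>

lemma sole_defender_iff_singleton_colour:
  assumes "proper_colouring c"
  shows "(\<exists>v. sole_defender c x v \<and> c v = i) \<longleftrightarrow>
    i \<noteq> c x \<and> card (closed_nbhd x \<inter> colour_class c i) = 1"
proof
  assume "\<exists>v. sole_defender c x v \<and> c v = i"
  then show "i \<noteq> c x \<and> card (closed_nbhd x \<inter> colour_class c i) = 1"
    using proper_colouring_adj_neq[OF assms] by (auto simp: sole_defender_def)
next
  assume i: "i \<noteq> c x \<and> card (closed_nbhd x \<inter> colour_class c i) = 1"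
  then obtain v where v: "closed_nbhd x \<inter> colour_class c i = {v}"
    by (auto simp: card_1_singleton_iff)
  then have "c v = i" "v \<in> closed_nbhd x"
    by (auto simp: colour_class_def)
  with i v show "\<exists>v. sole_defender c x v \<and> c v = i"
    by (auto simp: sole_defender_def in_closed_nbhd_iff)
qed

lemma sum_profile:
  fixes c :: "bit ^ 'n \<Rightarrow> nat"
  assumes "range c = {1..q}"
  shows "(\<Sum>i\<in>{1..q}. card (closed_nbhd x \<inter> colour_class c i)) = CARD('n) + 1"
proof -
  have "closed_nbhd x = (\<Union>i\<in>{1..q}. closed_nbhd x \<inter> colour_class c i)"
    using assms by (auto simp: colour_class_def)
  then have "CARD('n) + 1 = card (\<Union>i\<in>{1..q}. closed_nbhd x \<inter> colour_class c i)"
    using card_closed_nbhd[of x] by argo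
  also have "\<dots> = (\<Sum>i\<in>{1..q}. card (closed_nbhd x \<inter> colour_class c i))"
    by (rule card_UN_disjoint) (auto simp: colour_class_def)
  finally show ?thesis ..
qed

lemma pair_defensive_colouringD:
  assumes "pair_defensive_colouring I q c"
  shows "range c = {1..q}" and "proper_colouring c"
    and "\<lbrakk>i \<in> {1..q}; S \<subseteq> I; card S \<le> 2\<rbrakk> \<Longrightarrow>
      \<exists>f. inj_on f S \<and> (\<forall>x\<in>S. f x \<in> colour_class c i \<and> f x \<in> closed_nbhd x)"
proof -
  note unfolded = assms[unfolded pair_defensive_colouring_def defensive_silver_colouring_def]
  show "range c = {1..q}"
    by (rule unfolded[THEN conjunct1])
  show "proper_colouring c"
    by (rule unfolded[THEN conjunct2, THEN conjunct1])
  show "\<exists>f. inj_on f S \<and> (\<forall>x\<in>S. f x \<in> colour_class c i \<and> f x \<in> closed_nbhd x)"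
    if "i \<in> {1..q}" "S \<subseteq> I" "card S \<le> 2"
    by (rule unfolded[THEN conjunct2, THEN conjunct2, rule_format]) (intro conjI that)+
qed

lemma colour_occurs:
  assumes "pair_defensive_colouring I q c" and "x \<in> I" and "i \<in> {1..q}"
  shows "card (closed_nbhd x \<inter> colour_class c i) \<ge> 1"
proof -
  obtain f where "f x \<in> colour_class c i" "f x \<in> closed_nbhd x"
    using pair_defensive_colouringD(3)[OF assms(1,3), of "{x}"] assms(2) by auto
  then have "closed_nbhd x \<inter> colour_class c i \<noteq> {}"
    by blast
  then show ?thesis
    by (simp add: Suc_le_eq card_gt_0_iff)
qed

text \<open>
  Without a sole defender, the colour of \<open>x\<close> would occur once and each of the other \<open>q - 1\<close> colours
  at least twice, which needs \<open>2q - 1\<close> vertices in \<open>N[x]\<close>; there are at most \<open>2q - 2\<close>.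
\<close>

lemma sole_defender_exists:
  fixes c :: "bit ^ 'n \<Rightarrow> nat"
  assumes pd: "pair_defensive_colouring I q c" and x: "x \<in> I" and dim: "CARD('n) + 3 \<le> 2 * q"
  shows "\<exists>v. sole_defender c x v"
proof (rule ccontr)
  let ?n = "\<lambda>i. card (closed_nbhd x \<inter> colour_class c i)"
  assume none: "\<nexists>v. sole_defender c x v"
  have proper: "proper_colouring c" and range: "range c = {1..q}"
    by (fact pair_defensive_colouringD[OF pd])+
  have cx: "c x \<in> {1..q}"
    using range by blast
  have "?n i \<ge> 2" if "i \<in> {1..q} - {c x}" for i
  proof -
    have "?n i \<noteq> 1"
      using none that sole_defender_iff_singleton_colour[OF proper, of x i] by blast
    with colour_occurs[OF pd x, of i] that show ?thesis
      by simp
  qed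
  then have "(\<Sum>i\<in>{1..q} - {c x}. 2) \<le> (\<Sum>i\<in>{1..q} - {c x}. ?n i)"
    by (rule sum_mono)
  moreover have "(\<Sum>i\<in>{1..q}. ?n i) = ?n (c x) + (\<Sum>i\<in>{1..q} - {c x}. ?n i)"
    using cx by (simp add: sum.remove)
  moreover have "(\<Sum>i\<in>{1..q} - {c x}. 2) = 2 * (q - 1)"
    using cx by simp
  moreover have "?n (c x) = 1"
    by (simp add: closed_nbhd_own_colour[OF proper])
  ultimately show False
    using sum_profile[OF range, of x] dim by linarith
qed

text \<open>
  If \<open>v\<close> were the sole defender of both \<open>x\<close> and \<open>y\<close>, an injective assignment of defenders of its
  colour to the pair \<open>{x, y}\<close> would have to send both vertices to \<open>v\<close>.
\<close>

lemma sole_defender_of_unique: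
  assumes pd: "pair_defensive_colouring I q c" and "x \<in> I" "y \<in> I"
    and v: "sole_defender c x v" "sole_defender c y v"
  shows "x = y"
proof -
  have "c v \<in> {1..q}"
    using pair_defensive_colouringD(1)[OF pd] rangeI[of c v] by simp
  moreover have "{x, y} \<subseteq> I" "card {x, y} \<le> 2"
    using \<open>x \<in> I\<close> \<open>y \<in> I\<close> by (simp_all add: card_insert_if)
  ultimately obtain f where inj: "inj_on f {x, y}"
    and f: "\<forall>z\<in>{x, y}. f z \<in> colour_class c (c v) \<and> f z \<in> closed_nbhd z"
    using pair_defensive_colouringD(3)[OF pd, of "c v" "{x, y}"] by blast
  from f v have "f x = v" "f y = v"
    by (metis IntI insertI1 insertI2 sole_defender_def singletonD)+
  then show ?thesis
    using inj_onD[OF inj, of x y] by simp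
qed

section \<open>The profile and the matching\<close>

lemma map_perm_ones_twos:
  fixes g :: "nat \<Rightarrow> nat"
  assumes ab: "{a, b} \<subseteq> {1..q}" "a \<noteq> b" and "g a = 1" "g b = 1"
    and twos: "\<And>i. i \<in> {1..q} - {a, b} \<Longrightarrow> g i = 2"
  shows "map g [1..<q + 1] <~~> 1 # 1 # replicate (q - 2) 2"
proof -
  let ?R = "{1..q} - {a, b}"
  have "mset (map g [1..<q + 1]) = image_mset g (mset_set {1..q})"
    by (simp add: atLeastLessThanSuc_atLeastAtMost del: upt_Suc)
  also have "{1..q} = insert a (insert b ?R)"
    using ab by auto
  also have "image_mset g (mset_set \<dots>) = {#g a, g b#} + image_mset g (mset_set ?R)"
    using ab by (simp add: add_mset_commute)
  also have "image_mset g (mset_set ?R) = image_mset (\<lambda>_. 2) (mset_set ?R)"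
    using twos by (intro image_mset_cong) simp
  also have "\<dots> = replicate_mset (q - 2) 2"
    using ab by (simp add: image_mset_const_eq card_Diff_subset numeral_2_eq_2)
  finally show ?thesis
    using assms by simp
qed

text \<open>
  The colours other than \<open>a\<close> and \<open>b\<close> each occur at least twice in \<open>N[x]\<close>, and there are exactly
  \<open>2 (q - 2)\<close> vertices left for these \<open>q - 2\<close> colours, so each of the lower bounds is attained.
\<close>

lemma profile_eq_two:
  fixes c :: "bit ^ 'n \<Rightarrow> nat"
  assumes pd: "pair_defensive_colouring I q c" and x: "x \<in> I" and dim: "CARD('n) + 3 = 2 * q"
    and ones: "{i \<in> {1..q}. card (closed_nbhd x \<inter> colour_class c i) = 1} = {a, b}" and "a \<noteq> b"
    and i: "i \<in> {1..q} - {a, b}"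
  shows "card (closed_nbhd x \<inter> colour_class c i) = 2"
proof -
  let ?n = "\<lambda>i. card (closed_nbhd x \<inter> colour_class c i)"
  let ?R = "{1..q} - {a, b}"
  have range: "range c = {1..q}"
    using pair_defensive_colouringD(1)[OF pd] .
  have ab: "{a, b} \<subseteq> {1..q}" and one: "?n a = 1" "?n b = 1"
    using ones by blast+
  have ge: "2 \<le> ?n j" if "j \<in> ?R" for j
    using colour_occurs[OF pd x, of j] ones that by fastforce
  have "(\<Sum>j\<in>{1..q}. ?n j) = (\<Sum>j\<in>?R. ?n j) + (\<Sum>j\<in>{a, b}. ?n j)"
    using ab by (simp add: sum.subset_diff)
  then have "(\<Sum>j\<in>?R. ?n j) = 2 * (q - 2)"
    using sum_profile[OF range, of x] dim one \<open>a \<noteq> b\<close> by simp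
  also have "\<dots> = (\<Sum>j\<in>?R. 2)"
    using ab \<open>a \<noteq> b\<close> by (simp add: card_Diff_subset)
  finally show ?thesis
    using sum_mono_inv[of "\<lambda>_. 2" ?R ?n] ge i by simp
qed

theorem lemma4p1:
  fixes c :: "bit ^ 'n \<Rightarrow> nat" and I D :: "(bit ^ 'n) set" and q :: nat
  assumes "q \<ge> 2" and "CARD('n) = 2 * q - 3"
    and "(I, D) \<in> {(even_class, odd_class), (odd_class, even_class)}"
    and "extremal_pair_defensive_colouring I q c"
  shows "(\<forall>x\<in>I. closed_profile c q x <~~> 1 # 1 # replicate (q - 2) 2) \<and>
    (\<exists>other_colour defender.
       (\<forall>x\<in>I.
          other_colour x \<noteq> c x \<and>
          {i \<in> {1..q}. card (closed_nbhd x \<inter> colour_class c i) = 1} = {c x, other_colour x} \<and>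
          closed_nbhd x \<inter> colour_class c (c x) = {x} \<and>
          closed_nbhd x \<inter> colour_class c (other_colour x) = {defender x} \<and>
          defender x \<in> D \<and> hypercube_adj x (defender x)) \<and>
       bij_betw defender I D)"
proof -
  have pd: "pair_defensive_colouring I q c"
    using assms(4) unfolding extremal_pair_defensive_colouring_def by (rule conjunct1)
  have dim: "CARD('n) + 3 = 2 * q"
    using assms(1,2) by simp
  have proper: "proper_colouring c" and range: "range c = {1..q}"
    by (fact pair_defensive_colouringD[OF pd])+
  have adj_D: "v \<in> D" if "x \<in> I" "hypercube_adj x v" for x v
    using that assms(3)
    by (auto simp: hypercube_adj_iff_flip even_class_def odd_class_def even_hamming_weight_flip)
  have card_ID: "card I = card D"
    using assms(3) card_even_class by auto

  define defender where "defender x = (SOME v. sole_defender c x v)" for x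
  have defender: "sole_defender c x (defender x)" if "x \<in> I" for x
    using sole_defender_exists[OF pd that] dim unfolding defender_def by (simp add: someI_ex)
  have "inj_on defender I"
    by (rule inj_onI) (metis defender sole_defender_of_unique[OF pd])
  moreover have "defender ` I \<subseteq> D"
    using defender adj_D by (auto simp: sole_defender_def)
  ultimately have bij: "bij_betw defender I D"
    using card_ID by (metis bij_betw_def card_image card_subset_eq finite)

  have unique: "w = defender x" if "x \<in> I" "sole_defender c x w" for x w
  proof -
    have "w \<in> D"
      using that adj_D by (auto simp: sole_defender_def)
    then obtain y where y: "y \<in> I" "w = defender y"
      using bij by (auto simp: bij_betw_def)
    then have "y = x"
      using sole_defender_of_unique[OF pd] defender that by metis
    with y show ?thesis
      by simp
  qed

  let ?o = "\<lambda>x. c (defender x)"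
  have ones: "{i \<in> {1..q}. card (closed_nbhd x \<inter> colour_class c i) = 1} = {c x, ?o x}"
    and other: "?o x \<noteq> c x" if x: "x \<in> I" for x
  proof -
    have "(i \<noteq> c x \<and> card (closed_nbhd x \<inter> colour_class c i) = 1) \<longleftrightarrow> i = ?o x" for i
      unfolding sole_defender_iff_singleton_colour[OF proper, symmetric]
      using unique defender x by metis
    moreover have "c x \<in> {1..q}" "?o x \<in> {1..q}"
      using range by blast+
    moreover have "card (closed_nbhd x \<inter> colour_class c (c x)) = 1"
      by (simp add: closed_nbhd_own_colour[OF proper])
    ultimately show
      "{i \<in> {1..q}. card (closed_nbhd x \<inter> colour_class c i) = 1} = {c x, ?o x}" "?o x \<noteq> c x"
      by blast+
  qed

  have "closed_profile c q x <~~> 1 # 1 # replicate (q - 2) 2" if x: "x \<in> I" for x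
    unfolding closed_profile_def
  proof (rule map_perm_ones_twos)
    show "{c x, ?o x} \<subseteq> {1..q}" "card (closed_nbhd x \<inter> colour_class c (c x)) = 1"
      "card (closed_nbhd x \<inter> colour_class c (?o x)) = 1"
      using ones[OF x] by blast+
    show "c x \<noteq> ?o x"
      using other[OF x] by simp
    then show "card (closed_nbhd x \<inter> colour_class c i) = 2" if "i \<in> {1..q} - {c x, ?o x}" for i
      using profile_eq_two[OF pd x dim ones[OF x]] that by blast
  qed
  moreover have "?o x \<noteq> c x \<and>
      {i \<in> {1..q}. card (closed_nbhd x \<inter> colour_class c i) = 1} = {c x, ?o x} \<and>
      closed_nbhd x \<inter> colour_class c (c x) = {x} \<and>
      closed_nbhd x \<inter> colour_class c (?o x) = {defender x} \<and>
      defender x \<in> D \<and> hypercube_adj x (defender x)" if x: "x \<in> I" for x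
    using ones[OF x] other[OF x] closed_nbhd_own_colour[OF proper] defender[OF x] adj_D[OF x]
    by (auto simp: sole_defender_def)
  ultimately show ?thesis
    using bij by (intro conjI ballI exI[of _ ?o] exI[of _ defender]) blast+
qed

end
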